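(* Let $d$ be odd, let $\Gamma\subseteq\mathrm{Sym}(N)$ be a permutation group, and let $v,\bar v\in\mathcal{S}_d(\Gamma)$ be non-equivalent, irreducible arrangements whose arrangement spaces are not orthogonal to each other. Then $v$ and $\bar v$ are deformation equivalent.
   Context: Let $n,d\ge 1$ and $N=\{1,\dots,n\}$. A $d$-dimensional arrangement is a family of points $v_i\in\mathbb{R}^d$, $i\in N$; its matrix $M\in\mathbb{R}^{n\times d}$ has $i$-th row $v_i^\top$ and its arrangement space is the column span $U=\mathrm{span}\,M\subseteq\mathbb{R}^n$. Two arrangements are equivalent if they have the same arrangement space. An arrangement is normalized if $M^\top M=\mathrm{Id}$. For a permutation group $\Gamma\subseteq\mathrm{Sym}(N)$, $v$ is a $\Gamma$-arrangement if there is a group homomorphism $T\colon\Gamma\to\mathrm{O}(\mathbb{R}^d)$ with $T_\phi v_i=v_{\phi(i)}$ for all $i\in N$, $\phi\in\Gamma$; $T$ is called the representation of $v$ (it is unique if the $v_i$ span $\mathbb{R}^d$, in particular if $v$ is normalized). $v$ is irreducible if its representation is irreducible over $\mathbb{R}$. $\mathcal{S}_d(\Gamma)$ is the set of $d$-dimensional normalized $\Gamma$-arrangements on $N$, with the subspace topology from $(\mathbb{R}^d)^n$. Two arrangements $v,\bar v\in\mathcal{S}_d(\Gamma)$ are deformation equivalent if there is a continuous map $v(\cdot)\colon[0,1]\to\mathcal{S}_d(\Gamma)$ with $v(0)=v$ and $v(1)=\bar v$. *)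

theory Defs
  imports "HOL-Analysis.Analysis" "HOL-Algebra.Bij"
begin

text \<open>
  A \<open>d\<close>-dimensional arrangement on \<open>n\<close> points is identified with its matrix \<open>M\<close>, of type
  \<open>real^'d^'n\<close>, where \<open>n = CARD('n)\<close> and \<open>d = CARD('d)\<close>: the point \<open>v\<^sub>i\<close> is the row \<open>M $ i\<close>, and the
  topology of this type is the product topology of \<open>(\<real>\<^sup>d)\<^sup>n\<close>.
\<close>

definition arrangement_space :: "real^'d^'n \<Rightarrow> (real^'n) set"
  where "arrangement_space M = span (columns M)"

definition equivalent_arrangements :: "real^'d^'n \<Rightarrow> real^'d^'n \<Rightarrow> bool"
  where "equivalent_arrangements v w \<longleftrightarrow> arrangement_space v = arrangement_space w"

definition normalized :: "real^'d^'n \<Rightarrow> bool"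
  where "normalized M \<longleftrightarrow> transpose M ** M = mat 1"

definition orthogonal_spaces :: "(real^'n) set \<Rightarrow> (real^'n) set \<Rightarrow> bool"
  where "orthogonal_spaces U W \<longleftrightarrow> (\<forall>x\<in>U. \<forall>y\<in>W. orthogonal x y)"

text \<open>\<open>BijGroup UNIV\<close> is the symmetric group on the type \<open>'n\<close>, with composition as product.\<close>

definition permutation_group :: "('n::finite \<Rightarrow> 'n) set \<Rightarrow> bool"
  where "permutation_group \<Gamma> \<longleftrightarrow> subgroup \<Gamma> (BijGroup UNIV)"

definition orthogonal_group :: "(real^'d^'d) monoid"
  where "orthogonal_group = \<lparr>carrier = {A. orthogonal_matrix A}, mult = (**), one = mat 1\<rparr>"

definition is_representation ::
    "('n::finite \<Rightarrow> 'n) set \<Rightarrow> (('n \<Rightarrow> 'n) \<Rightarrow> real^'d^'d) \<Rightarrow> real^'d^'n \<Rightarrow> bool"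
  where "is_representation \<Gamma> T v \<longleftrightarrow>
    T \<in> hom ((BijGroup UNIV)\<lparr>carrier := \<Gamma>\<rparr>) orthogonal_group \<and>
    (\<forall>\<phi>\<in>\<Gamma>. \<forall>i. T \<phi> *v (v $ i) = v $ (\<phi> i))"

definition is_arrangement :: "('n::finite \<Rightarrow> 'n) set \<Rightarrow> real^'d^'n \<Rightarrow> bool"
  where "is_arrangement \<Gamma> v \<longleftrightarrow> (\<exists>T. is_representation \<Gamma> T v)"

text \<open>The representation space \<open>real^'d\<close> is never zero, so no separate nontriviality clause is needed.\<close>

definition irreducible_representation ::
    "('n \<Rightarrow> 'n) set \<Rightarrow> (('n \<Rightarrow> 'n) \<Rightarrow> real^'d^'d) \<Rightarrow> bool"
  where "irreducible_representation \<Gamma> T \<longleftrightarrow>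
    (\<forall>W. subspace W \<and> (\<forall>\<phi>\<in>\<Gamma>. \<forall>x\<in>W. T \<phi> *v x \<in> W) \<longrightarrow> W = {0} \<or> W = UNIV)"

text \<open>
  The representation of an arrangement spanning \<open>\<real>\<^sup>d\<close>, in particular of a normalized one, is unique
  on \<open>\<Gamma>\<close>, so for such an arrangement the existential quantifier refers to that representation.
\<close>

definition irreducible_arrangement :: "('n::finite \<Rightarrow> 'n) set \<Rightarrow> real^'d^'n \<Rightarrow> bool"
  where "irreducible_arrangement \<Gamma> v \<longleftrightarrow>
    (\<exists>T. is_representation \<Gamma> T v \<and> irreducible_representation \<Gamma> T)"

definition normalized_arrangements :: "('n::finite \<Rightarrow> 'n) set \<Rightarrow> (real^'d^'n) set"
  where "normalized_arrangements \<Gamma> = {v. is_arrangement \<Gamma> v \<and> normalized v}"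

definition deformation_equivalent ::
    "('n::finite \<Rightarrow> 'n) set \<Rightarrow> real^'d^'n \<Rightarrow> real^'d^'n \<Rightarrow> bool"
  where "deformation_equivalent \<Gamma> v w \<longleftrightarrow>
    (\<exists>g :: real \<Rightarrow> real^'d^'n. continuous_on {0..1} g \<and> g ` {0..1} \<subseteq> normalized_arrangements \<Gamma> \<and>
       g 0 = v \<and> g 1 = w)"

end

theory Submission imports Defs begin

text \<open>
  Let \<open>T\<close> and \<open>S\<close> be the representations of \<open>v\<close> and \<open>w\<close>. The matrix \<open>M = w\<^sup>T v\<close> of inner products
  between columns intertwines them, \<open>M T\<^sub>\<phi> = S\<^sub>\<phi> M\<close>, because reindexing the sum over \<open>i\<close> by \<open>\<phi>\<close>
  does not change it. Hence \<open>\<bar>M x\<bar>\<close> is a \<open>T\<close>-invariant function of \<open>x\<close>, and a form of Schur's lemma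
  (\<open>irreducible_imp_norm_scaling\<close>) makes it \<open>c \<bar>x\<bar>\<close> for a constant \<open>c \<ge> 0\<close>. Since the arrangement
  spaces are not orthogonal, \<open>c > 0\<close>, so \<open>M\<close> is \<open>c\<close> times an orthogonal matrix.

  Let \<open>Q\<close> be that orthogonal matrix or its negative. Then \<open>w Q\<close> has the same representation \<open>T\<close> as
  \<open>v\<close>, and the linear isometries \<open>v\<close> and \<open>w Q\<close> enclose a constant angle: \<open>v x \<bullet> w Q x = \<plusminus>c \<bar>x\<bar>\<^sup>2\<close>.
  The squared distance of \<open>v x\<close> and \<open>\<plusminus>w Q x\<close> is \<open>2 (1 - c) \<bar>x\<bar>\<^sup>2\<close>, so \<open>c \<ge> 1\<close> would force \<open>v = \<plusminus>w Q\<close>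
  and hence equal arrangement spaces. So \<open>c < 1\<close>, no point of the segment from \<open>v\<close> to \<open>w Q\<close> is degenerate, and each of its
  points becomes normalized after division by a scalar; this is a path from \<open>v\<close> to \<open>w Q\<close>
  (\<open>path_component_common_representation\<close>).

  It remains to join \<open>w Q\<close> to \<open>w\<close>, for which a path from \<open>Q\<close> to the identity in the orthogonal group
  suffices. Here the dimension enters: if \<open>d\<close> is odd, \<open>Q\<close> and \<open>-Q\<close> have determinants of opposite sign,
  so for one of the two choices \<open>Q\<close> lies in the identity component. The argument below replaces
  determinants by reflections: all reflections lie in one path component, every orthogonal matrix is
  a product of reflections and is therefore joined either to the identity or to a reflection, and
  \<open>-1\<close> is a product of \<open>d\<close> reflections and therefore interchanges these two classes.
\<close>

section \<open>Matrices with orthonormal columns\<close>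

lemma inner_matrix_vector_mult:
  fixes A :: "real^'d^'n" and B :: "real^'e^'n"
  shows "(A *v x) \<bullet> (B *v y) = x \<bullet> ((transpose A ** B) *v y)"
  by (metis dot_lmul_matrix matrix_vector_mul_assoc vector_transpose_matrix)

lemma normalized_iff_inner:
  fixes A :: "real^'d^'n"
  shows "normalized A \<longleftrightarrow> (\<forall>x y. (A *v x) \<bullet> (A *v y) = x \<bullet> y)"
proof -
  have "normalized A \<longleftrightarrow> (\<forall>y. (transpose A ** A) *v y = y)"
    by (simp only: normalized_def matrix_eq matrix_vector_mul_lid)
  also have "\<dots> \<longleftrightarrow> (\<forall>y x. x \<bullet> ((transpose A ** A) *v y) = x \<bullet> y)"
    by (simp only: vector_eq_ldot)
  finally show ?thesis
    by (auto simp only: inner_matrix_vector_mult)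
qed

lemma normalized_iff_norm:
  fixes A :: "real^'d^'n"
  shows "normalized A \<longleftrightarrow> (\<forall>x. norm (A *v x) = norm x)"
proof
  assume "normalized A"
  then show "\<forall>x. norm (A *v x) = norm x"
    by (simp add: normalized_iff_inner norm_eq_sqrt_inner)
next
  assume *: "\<forall>x. norm (A *v x) = norm x"
  then have "(A *v x) \<bullet> (A *v y) = x \<bullet> y" for x y
    by (simp add: dot_norm flip: matrix_vector_right_distrib)
  then show "normalized A" by (simp add: normalized_iff_inner)
qed

lemma orthogonal_matrix_iff_norm:
  fixes Q :: "real^'d^'d"
  shows "orthogonal_matrix Q \<longleftrightarrow> (\<forall>x. norm (Q *v x) = norm x)"
  by (metis orthogonal_matrix normalized_def normalized_iff_norm)

lemma inner_orthogonal_matrix: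
  fixes Q :: "real^'d^'d"
  shows "orthogonal_matrix Q \<Longrightarrow> (Q *v x) \<bullet> (Q *v y) = x \<bullet> y"
  unfolding orthogonal_matrix normalized_def[symmetric] normalized_iff_inner by blast

lemma arrangement_space_eq_range:
  fixes A :: "real^'d^'n"
  shows "arrangement_space A = range ((*v) A)"
proof
  have "columns A \<subseteq> range ((*v) A)"
    by (auto simp: columns_def simp flip: matrix_vector_mult_basis)
  moreover have "subspace (range ((*v) A))"
    by (simp add: linear_subspace_image)
  ultimately show "arrangement_space A \<subseteq> range ((*v) A)"
    unfolding arrangement_space_def by (rule span_minimal)
qed (auto simp: arrangement_space_def matrix_vector_mult_in_columnspace)

lemma matrix_vector_mult_uminus_left:
  fixes A :: "real^'d^'n"
  shows "(- A) *v x = - (A *v x)"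
  by (simp add: vec_eq_iff matrix_vector_mult_def sum_negf)

section \<open>Paths in the orthogonal group\<close>

lemma path_component_continuous_image:
  assumes "path_component S x y" "continuous_on S f" "f ` S \<subseteq> T"
  shows "path_component T (f x) (f y)"
proof -
  obtain g where "path g" "path_image g \<subseteq> S" "pathstart g = x" "pathfinish g = y"
    using assms(1) unfolding path_component_def by blast
  then show ?thesis
    unfolding path_component_def using assms(2,3)
    by (intro exI[of _ "f \<circ> g"])
       (auto simp: path_image_compose pathstart_compose pathfinish_compose
         intro!: path_continuous_image intro: continuous_on_subset)
qed

lemma continuous_on_matrix_mult_left:
  fixes C :: "real^'d^'n"
  shows "continuous_on S (\<lambda>X::real^'e^'d. C ** X)"
  by (intro linear_continuous_on linear_conv_bounded_linear[THEN iffD1] linearI)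
     (simp_all add: vec_eq_iff matrix_matrix_mult_def sum.distrib sum_distrib_left algebra_simps)

lemma continuous_on_matrix_mult_right:
  fixes C :: "real^'e^'d"
  shows "continuous_on S (\<lambda>X::real^'d^'n. X ** C)"
  by (intro linear_continuous_on linear_conv_bounded_linear[THEN iffD1] linearI)
     (simp_all add: vec_eq_iff matrix_matrix_mult_def sum.distrib sum_distrib_left algebra_simps)

abbreviation orthogonally_connected :: "real^'d^'d \<Rightarrow> real^'d^'d \<Rightarrow> bool" (infix "\<asymp>" 50)
  where "A \<asymp> B \<equiv> path_component {Q. orthogonal_matrix Q} A B"

lemma orthogonally_connected_mult:
  assumes "A \<asymp> A'" "B \<asymp> B'"
  shows "A ** B \<asymp> A' ** B'"
proof (rule path_component_trans)
  have "orthogonal_matrix A'" "orthogonal_matrix B"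
    using assms path_component_mem by blast+
  then show "A ** B \<asymp> A' ** B" "A' ** B \<asymp> A' ** B'"
    using assms
    by (auto intro!: path_component_continuous_image[where f = "\<lambda>X. X ** B"]
        path_component_continuous_image[where f = "\<lambda>X. A' ** X"]
        continuous_on_matrix_mult_left continuous_on_matrix_mult_right orthogonal_matrix_mul)
qed

text \<open>
  The reflection in the hyperplane orthogonal to \<open>u\<close>. The vector is not assumed to be of unit length,
  so that \<open>u\<close> can move along a segment; the value for \<open>u = 0\<close> is the identity.
\<close>

definition reflection :: "real^'d \<Rightarrow> real^'d^'d"
  where "reflection u = mat 1 - (2 / (u \<bullet> u)) *\<^sub>R (\<chi> i j. u $ i * u $ j)"

lemma reflection_mult: "reflection u *v x = x - (2 * (u \<bullet> x) / (u \<bullet> u)) *\<^sub>R u"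
proof -
  have "(\<chi> i j. u $ i * u $ j) *v x = (u \<bullet> x) *\<^sub>R u"
    by (simp add: vec_eq_iff matrix_vector_mult_def inner_vec_def sum_distrib_left mult_ac)
  then show ?thesis
    by (simp add: reflection_def matrix_vector_mult_diff_rdistrib flip: scaleR_matrix_vector_assoc)
qed

lemma orthogonal_matrix_reflection: "orthogonal_matrix (reflection u)"
proof -
  have "(x - (2 * (u \<bullet> x) / (u \<bullet> u)) *\<^sub>R u) \<bullet> (x - (2 * (u \<bullet> x) / (u \<bullet> u)) *\<^sub>R u) = x \<bullet> x" for x
    by (cases "u = 0") (simp_all add: inner_diff inner_commute field_simps)
  then show ?thesis
    by (simp add: orthogonal_matrix_iff_norm reflection_mult norm_eq_sqrt_inner)
qed

lemma reflection_involution: "reflection u ** reflection u = mat 1"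
proof -
  have "reflection u *v (reflection u *v x) = x" for x
    by (cases "u = 0") (simp_all add: reflection_mult inner_diff field_simps flip: scaleR_add_left)
  then show ?thesis by (simp add: matrix_eq matrix_vector_mul_assoc)
qed

lemma reflection_scaleR: "k \<noteq> 0 \<Longrightarrow> reflection (k *\<^sub>R u) = reflection u"
  by (simp add: matrix_eq reflection_mult)

text \<open>
  Moving \<open>u\<close> to \<open>w\<close> along a straight segment moves the reflection continuously unless the segment
  meets the origin; but then \<open>u\<close> and \<open>w\<close> are parallel and define the same reflection. Dimension one,
  where the unit sphere is disconnected, thus needs no separate treatment.
\<close>

lemma reflections_connected:
  assumes "u \<noteq> 0" "w \<noteq> 0"
  shows "reflection u \<asymp> reflection w"
proof (cases "0 \<in> closed_segment u w")
  case True
  then obtain t where t: "0 \<le> t" "t \<le> 1" "0 = (1 - t) *\<^sub>R u + t *\<^sub>R w"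
    by (auto simp: in_segment)
  then have "t \<noteq> 0" "t \<noteq> 1" using assms by auto
  then have "w = (- (1 - t) / t) *\<^sub>R u"
    using t(3) by (simp add: vec_eq_iff field_simps)
  then have "reflection w = reflection u"
    using \<open>t \<noteq> 0\<close> \<open>t \<noteq> 1\<close> reflection_scaleR[of "- (1 - t) / t" u] by simp
  then show ?thesis by (simp add: path_component_refl orthogonal_matrix_reflection)
next
  case False
  then have "x \<bullet> x \<noteq> 0" if "x \<in> closed_segment u w" for x
    using that by auto
  then have "continuous_on (closed_segment u w) reflection"
    unfolding reflection_def by (intro continuous_intros) auto
  moreover have "path_component (closed_segment u w) u w"
    by (rule path_component_linepath) simp
  moreover have "reflection ` closed_segment u w \<subseteq> {Q. orthogonal_matrix Q}"
    by (auto simp: orthogonal_matrix_reflection)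
  ultimately show ?thesis
    using path_component_continuous_image[where f = reflection] by blast
qed

text \<open>
  If \<open>Q\<close> moves the basis vector \<open>x\<close>, the reflection along \<open>h = Q x - x\<close> sends \<open>Q x\<close> back to \<open>x\<close>.
  It also fixes every fixed vector of \<open>Q\<close>, because such a vector is orthogonal to \<open>h\<close>. Composing with it
  thus reduces the number of basis vectors that are moved, and since all reflections are joined to
  each other, each such step interchanges the two alternatives.
\<close>

lemma orthogonal_matrix_connected_cases:
  fixes Q :: "real^'d^'d"
  assumes "orthogonal_matrix Q" "u \<noteq> 0"
  shows "Q \<asymp> mat 1 \<or> Q \<asymp> reflection u"
  using assms(1)
proof (induction "card {i. Q *v axis i 1 \<noteq> axis i 1}" arbitrary: Q rule: less_induct)
  case less
  have inner_Q: "(Q *v x) \<bullet> (Q *v y) = x \<bullet> y" for x y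
    using less.prems by (rule inner_orthogonal_matrix)
  show ?case
  proof (cases "\<exists>i. Q *v axis i 1 \<noteq> axis i 1")
    case False
    then have "column i Q = axis i 1" for i
      by (metis matrix_vector_mult_basis)
    then have "Q = mat 1"
      by (auto simp: vec_eq_iff column_def axis_def mat_def)
    then show ?thesis by (simp add: path_component_refl orthogonal_matrix_id)
  next
    case True
    then obtain i where i: "Q *v axis i 1 \<noteq> axis i 1" by blast
    define x where "x = axis i (1::real)"
    define h where "h = Q *v x - x"
    define R where "R = reflection h ** Q"
    have "h \<noteq> 0" using i by (simp add: h_def x_def)
    have "orthogonal_matrix R"
      by (simp add: R_def less.prems orthogonal_matrix_mul orthogonal_matrix_reflection)
    have fix_x: "R *v x = x"
    proof -
      have "h \<bullet> h = 2 * (h \<bullet> (Q *v x))"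
        using inner_Q[of x x] by (simp add: h_def inner_diff inner_commute)
      moreover have "h \<bullet> h \<noteq> 0"
        using \<open>h \<noteq> 0\<close> by simp
      ultimately have "2 * (h \<bullet> (Q *v x)) / (h \<bullet> h) = 1"
        by (metis divide_self)
      then have "R *v x = Q *v x - h"
        unfolding R_def matrix_vector_mul_assoc[symmetric] reflection_mult
        by (simp only: scaleR_one)
      then show ?thesis by (simp add: h_def)
    qed
    have keep: "R *v y = y" if "Q *v y = y" for y
    proof -
      have "h \<bullet> y = 0"
        using inner_Q[of x y] that by (simp add: h_def inner_diff)
      then show ?thesis
        by (simp add: R_def reflection_mult that flip: matrix_vector_mul_assoc)
    qed
    have "{j. R *v axis j 1 \<noteq> axis j 1} \<subset> {j. Q *v axis j 1 \<noteq> axis j 1}"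
      using keep fix_x i by (auto simp: x_def)
    then have "R \<asymp> mat 1 \<or> R \<asymp> reflection u"
      using less.hyps \<open>orthogonal_matrix R\<close> by (meson finite psubset_card_mono)
    moreover have "Q = reflection h ** R"
      by (simp add: R_def matrix_mul_assoc reflection_involution)
    ultimately show ?thesis
      using orthogonally_connected_mult[OF reflections_connected[OF \<open>h \<noteq> 0\<close> assms(2)]]
      by (metis matrix_mul_rid reflection_involution)
  qed
qed

text \<open>
  Flipping the signs of \<open>k\<close> coordinates is a product of \<open>k\<close> coordinate reflections, and any two
  reflections cancel up to a path.
\<close>

lemma minus_identity_connected_reflection:
  fixes u :: "real^'d"
  assumes "odd CARD('d)" "u \<noteq> 0"
  shows "- mat 1 \<asymp> reflection u"
proof -
  define flip :: "'d set \<Rightarrow> real^'d^'d"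
    where "flip S = (\<chi> i j. if i = j then if i \<in> S then - 1 else 1 else 0)" for S
  have flip_mult: "(flip S *v x) $ i = (if i \<in> S then - x $ i else x $ i)" for S x i
  proof -
    have "(flip S *v x) $ i = (\<Sum>j\<in>UNIV. if j = i then (if i \<in> S then - x $ i else x $ i) else 0)"
      unfolding matrix_vector_mult_def flip_def vec_lambda_beta by (rule sum.cong) auto
    then show ?thesis by simp
  qed
  have "flip S \<asymp> (if even (card S) then mat 1 else reflection u)" for S
    using finite[of S]
  proof induction
    case empty
    have "flip {} = mat 1" by (simp add: flip_def mat_def vec_eq_iff)
    then show ?case by (simp add: path_component_refl orthogonal_matrix_id)
  next
    case (insert k S)
    have "flip (insert k S) = reflection (axis k 1) ** flip S"
    proof -
      have "(flip (insert k S) *v x) $ i = (reflection (axis k 1) *v (flip S *v x)) $ i" for x i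
      proof -
        have "axis k (1::real) $ i = (if i = k then 1 else 0)"
          by (simp add: axis_def)
        then show ?thesis
          using insert.hyps by (simp add: flip_mult reflection_mult inner_axis')
      qed
      then show ?thesis
        by (simp add: matrix_eq vec_eq_iff matrix_vector_mul_assoc)
    qed
    moreover have "axis k (1::real) \<noteq> 0" by (simp add: axis_eq_0_iff)
    ultimately show ?case
      using orthogonally_connected_mult[OF reflections_connected[OF _ assms(2)] insert.IH]
        insert.hyps by (auto simp: reflection_involution)
  qed
  from this[of UNIV] show ?thesis
    using assms(1) by (simp add: flip_def mat_def uminus_vec_def if_distrib cong: if_cong)
qed

lemma orthogonal_matrix_or_minus_connected_identity:
  fixes Q :: "real^'d^'d"
  assumes "odd CARD('d)" "orthogonal_matrix Q"
  shows "Q \<asymp> mat 1 \<or> - Q \<asymp> mat 1"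
proof -
  obtain u :: "real^'d" where "u \<noteq> 0"
    by (metis axis_eq_0_iff zero_neq_one)
  have "- mat 1 ** Q = - Q"
    by (simp add: matrix_eq matrix_vector_mult_uminus_left flip: matrix_vector_mul_assoc)
  with orthogonal_matrix_connected_cases[OF assms(2) \<open>u \<noteq> 0\<close>] show ?thesis
    using orthogonally_connected_mult[OF minus_identity_connected_reflection[OF assms(1) \<open>u \<noteq> 0\<close>]]
    by (metis reflection_involution)
qed

section \<open>Irreducible representations\<close>

text \<open>
  A real Schur lemma that avoids eigenvalues. Let \<open>c\<close> be the maximum of \<open>\<bar>M x\<bar>\<close> on the unit sphere.
  The quadratic form \<open>q x = (c \<bar>x\<bar>)\<^sup>2 - \<bar>M x\<bar>\<^sup>2\<close> is nonnegative, so by the parallelogram identity its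
  zero set is a subspace. This subspace is invariant and contains a maximizer; irreducibility makes
  it the whole space.
\<close>

lemma irreducible_imp_norm_scaling:
  fixes T :: "('n \<Rightarrow> 'n) \<Rightarrow> real^'d^'d" and M :: "real^'d^'e"
  assumes irred: "irreducible_representation \<Gamma> T"
    and norm_T: "\<And>\<phi> x. \<phi> \<in> \<Gamma> \<Longrightarrow> norm (T \<phi> *v x) = norm x"
    and norm_M: "\<And>\<phi> x. \<phi> \<in> \<Gamma> \<Longrightarrow> norm (M *v (T \<phi> *v x)) = norm (M *v x)"
  obtains c where "c \<ge> 0" "\<And>x. norm (M *v x) = c * norm x"
proof -
  have "continuous_on (sphere 0 1) (\<lambda>x. norm (M *v x))"
    by (intro continuous_intros linear_continuous_on_compose matrix_vector_mul_linear)
  moreover have "sphere 0 1 \<noteq> ({} :: (real^'d) set)" by simp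
  ultimately obtain x0 :: "real^'d" where x0: "norm x0 = 1"
    and max: "\<And>y. norm y = 1 \<Longrightarrow> norm (M *v y) \<le> norm (M *v x0)"
    using continuous_attains_sup[of "sphere 0 1 :: (real^'d) set" "\<lambda>x. norm (M *v x)"] by auto
  define c where "c = norm (M *v x0)"
  have le: "norm (M *v x) \<le> c * norm x" for x
  proof (cases "x = 0")
    case False
    then have "norm (M *v ((1 / norm x) *\<^sub>R x)) \<le> c"
      unfolding c_def by (intro max) simp
    then show ?thesis
      using False by (simp add: matrix_vector_mult_scaleR field_simps)
  qed simp
  define q where "q x = (c * norm x)\<^sup>2 - (norm (M *v x))\<^sup>2" for x
  have "c \<ge> 0" by (simp add: c_def)
  have q_nonneg: "q x \<ge> 0" for x
    using le[of x] by (simp add: q_def power_mono)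
  have q_eq_0: "q x = 0 \<longleftrightarrow> norm (M *v x) = c * norm x" for x
    using \<open>c \<ge> 0\<close> by (auto simp: q_def power2_eq_iff_nonneg)
  have parallelogram: "q (x + y) + q (x - y) = 2 * q x + 2 * q y" for x y
    by (simp add: q_def power_mult_distrib power2_norm_eq_inner matrix_vector_right_distrib
        matrix_vector_mult_diff_distrib inner_add inner_diff inner_commute algebra_simps)
  have "subspace {x. q x = 0}"
  proof (rule subspaceI)
    fix x y assume "x \<in> {x. q x = 0}" "y \<in> {x. q x = 0}"
    then show "x + y \<in> {x. q x = 0}"
      using parallelogram[of x y] q_nonneg[of "x + y"] q_nonneg[of "x - y"] by simp
  next
    fix r x assume "x \<in> {x. q x = 0}"
    then show "r *\<^sub>R x \<in> {x. q x = 0}"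
      by (simp add: q_eq_0 matrix_vector_mult_scaleR)
  qed (simp add: q_def)
  moreover have "\<forall>\<phi>\<in>\<Gamma>. \<forall>x\<in>{x. q x = 0}. T \<phi> *v x \<in> {x. q x = 0}"
    by (simp add: q_def norm_T norm_M)
  ultimately have "{x. q x = 0} = {0} \<or> {x. q x = 0} = UNIV"
    using irred unfolding irreducible_representation_def by blast
  moreover have "q x0 = 0" "x0 \<noteq> 0"
    using x0 by (auto simp: q_def c_def)
  ultimately have "q x = 0" for x by blast
  then show thesis
    using that \<open>c \<ge> 0\<close> q_eq_0 by blast
qed

section \<open>Arrangements and their representations\<close>

lemma is_representation_orthogonal:
  "is_representation \<Gamma> T v \<Longrightarrow> \<phi> \<in> \<Gamma> \<Longrightarrow> orthogonal_matrix (T \<phi>)"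
  by (auto simp: is_representation_def hom_def orthogonal_group_def)

lemma bij_of_permutation_group:
  assumes "permutation_group \<Gamma>" "\<phi> \<in> \<Gamma>"
  shows "bij \<phi>"
proof -
  have "\<Gamma> \<subseteq> carrier (BijGroup UNIV)"
    using assms(1) unfolding permutation_group_def by (rule subgroup.subset)
  then show ?thesis
    using assms(2) by (auto simp: BijGroup_def Bij_def)
qed

lemma cross_gram_mult:
  fixes v :: "real^'d^'n" and w :: "real^'e^'n"
  shows "(transpose w ** v) *v x = (\<Sum>i\<in>UNIV. (v $ i \<bullet> x) *\<^sub>R w $ i)"
proof -
  have "(transpose w ** v) *v x = transpose w *v (v *v x)"
    by (simp add: matrix_vector_mul_assoc)
  also have "\<dots> = (\<Sum>i\<in>UNIV. (v $ i \<bullet> x) *\<^sub>R w $ i)"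
    by (simp add: vec_eq_iff matrix_vector_mult_def transpose_def inner_vec_def mult_ac)
  finally show ?thesis .
qed

lemma cross_gram_intertwines:
  fixes v :: "real^'d^'n" and w :: "real^'e^'n"
  assumes "permutation_group \<Gamma>" "is_representation \<Gamma> T v" "is_representation \<Gamma> S w" "\<phi> \<in> \<Gamma>"
  shows "(transpose w ** v) *v (T \<phi> *v x) = S \<phi> *v ((transpose w ** v) *v x)"
proof -
  have T: "v $ \<phi> i = T \<phi> *v (v $ i)" and S: "w $ \<phi> i = S \<phi> *v (w $ i)" for i
    using assms(2-4) by (auto simp: is_representation_def)
  have "(transpose w ** v) *v (T \<phi> *v x) = (\<Sum>i\<in>UNIV. (v $ i \<bullet> (T \<phi> *v x)) *\<^sub>R w $ i)"
    by (rule cross_gram_mult)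
  also have "\<dots> = (\<Sum>i\<in>UNIV. (v $ \<phi> i \<bullet> (T \<phi> *v x)) *\<^sub>R w $ \<phi> i)"
    using bij_of_permutation_group[OF assms(1,4)]
    by (rule sum.reindex_bij_betw[symmetric])
  also have "\<dots> = (\<Sum>i\<in>UNIV. S \<phi> *v ((v $ i \<bullet> x) *\<^sub>R w $ i))"
    using inner_orthogonal_matrix[OF is_representation_orthogonal[OF assms(2,4)]]
    by (simp add: T S matrix_vector_mult_scaleR)
  also have "\<dots> = S \<phi> *v ((transpose w ** v) *v x)"
    by (simp add: cross_gram_mult linear_sum)
  finally show ?thesis .
qed

lemma matrix_mult_row:
  fixes w :: "real^'d^'n" and Q :: "real^'e^'d"
  shows "(w ** Q) $ i = transpose Q *v (w $ i)"
  by (simp add: vec_eq_iff matrix_matrix_mult_def matrix_vector_mult_def transpose_def mult_ac)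

text \<open>
  Multiplying \<open>w\<close> by \<open>Q\<close> on the right applies the isometry \<open>Q\<^sup>T\<close> to all points, which conjugates the
  representation. The intertwining condition says that the conjugate of \<open>S\<close> is \<open>T\<close>; it is stated
  without inverses because that is the form in which \<open>M = w\<^sup>T v\<close> provides it.
\<close>

lemma is_representation_mult:
  fixes w :: "real^'d^'n" and Q :: "real^'d^'d"
  assumes S: "is_representation \<Gamma> S w" and Q: "orthogonal_matrix Q"
    and hom: "T \<in> hom ((BijGroup UNIV)\<lparr>carrier := \<Gamma>\<rparr>) orthogonal_group"
    and intertwine: "\<And>\<phi>. \<phi> \<in> \<Gamma> \<Longrightarrow> Q ** T \<phi> = S \<phi> ** Q"
  shows "is_representation \<Gamma> T (w ** Q)"
proof -
  have "T \<phi> *v (w ** Q) $ i = (w ** Q) $ \<phi> i" if "\<phi> \<in> \<Gamma>" for \<phi> i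
  proof -
    have "T \<phi> ** transpose Q = transpose Q ** (Q ** T \<phi>) ** transpose Q"
      using Q by (simp add: orthogonal_matrix_def matrix_mul_assoc)
    also have "\<dots> = transpose Q ** S \<phi>"
      using Q by (simp add: intertwine[OF that] orthogonal_matrix_def flip: matrix_mul_assoc)
    finally have "T \<phi> *v (transpose Q *v x) = transpose Q *v (S \<phi> *v x)" for x
      by (metis matrix_vector_mul_assoc)
    then show ?thesis
      using S that by (simp add: matrix_mult_row is_representation_def)
  qed
  with hom show ?thesis by (simp add: is_representation_def)
qed

lemma normalized_arrangements_mult:
  assumes w: "w \<in> normalized_arrangements \<Gamma>" and Q: "orthogonal_matrix Q"
  shows "w ** Q \<in> normalized_arrangements \<Gamma>"
proof -
  obtain S where S: "is_representation \<Gamma> S w"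
    using w by (auto simp: normalized_arrangements_def is_arrangement_def)
  have QQ: "Q ** (transpose Q ** X) = X" for X
    using Q by (simp add: orthogonal_matrix_def matrix_mul_assoc)
  have "(\<lambda>\<phi>. transpose Q ** S \<phi> ** Q) \<in> hom ((BijGroup UNIV)\<lparr>carrier := \<Gamma>\<rparr>) orthogonal_group"
    using S Q
    by (auto simp: is_representation_def hom_def orthogonal_group_def QQ
        simp flip: matrix_mul_assoc intro!: orthogonal_matrix_mul)
  then have "is_representation \<Gamma> (\<lambda>\<phi>. transpose Q ** S \<phi> ** Q) (w ** Q)"
    by (rule is_representation_mult[OF S Q]) (simp add: QQ flip: matrix_mul_assoc)
  moreover have "normalized (w ** Q)"
    using w Q
    by (simp add: normalized_arrangements_def normalized_iff_norm orthogonal_matrix_iff_norm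
        flip: matrix_vector_mul_assoc)
  ultimately show ?thesis
    by (auto simp: normalized_arrangements_def is_arrangement_def)
qed

lemma is_representation_linear_combination:
  assumes "is_representation \<Gamma> T v" "is_representation \<Gamma> T w"
  shows "is_representation \<Gamma> T (a *\<^sub>R v + b *\<^sub>R w)"
  using assms by (simp add: is_representation_def matrix_vector_right_distrib matrix_vector_mult_scaleR)

text \<open>
  The squared length of \<open>(1 - t) v x + t w x\<close> is \<open>((1 - t)\<^sup>2 + t\<^sup>2 + 2 t (1 - t) s) \<bar>x\<bar>\<^sup>2\<close>. The factor,
  called \<open>D t\<close> in the proof, does not depend on \<open>x\<close>, so the points of the segment can be normalized by
  scalars, which preserves the common representation.
\<close>

lemma path_component_common_representation:
  fixes v w :: "real^'d^'n"
  assumes rep: "is_representation \<Gamma> T v" "is_representation \<Gamma> T w"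
    and "normalized v" "normalized w"
    and angle: "\<And>x. (v *v x) \<bullet> (w *v x) = s * (x \<bullet> x)"
    and s: "\<bar>s\<bar> < 1"
  shows "path_component (normalized_arrangements \<Gamma>) v w"
proof -
  define D where "D t = 1 - 2 * (t * (1 - t)) * (1 - s)" for t
  define g where "g t = ((1 - t) / sqrt (D t)) *\<^sub>R v + (t / sqrt (D t)) *\<^sub>R w" for t
  have D_pos: "D t > 0" for t
  proof -
    \<comment> \<open>The minimum of \<open>D\<close> is \<open>(1 + s) / 2\<close>, at the midpoint; complete the square around it.\<close>
    have "D t = (1 - s) / 2 * (1 - 2 * t)\<^sup>2 + (1 + s) / 2"
      by (simp add: D_def power2_eq_square field_simps)
    also have "\<dots> > 0"
      using s by (intro add_nonneg_pos mult_nonneg_nonneg) auto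
    finally show ?thesis .
  qed
  have "g t \<in> normalized_arrangements \<Gamma>" for t
  proof -
    have "norm (g t *v x) = norm x" for x
    proof -
      define z where "z = (1 - t) *\<^sub>R (v *v x) + t *\<^sub>R (w *v x)"
      have "z \<bullet> z = (1 - t)\<^sup>2 * ((v *v x) \<bullet> (v *v x)) + t\<^sup>2 * ((w *v x) \<bullet> (w *v x))
            + 2 * t * (1 - t) * ((v *v x) \<bullet> (w *v x))"
        by (simp add: z_def inner_add inner_diff inner_commute power2_eq_square algebra_simps)
      also have "\<dots> = (1 - t)\<^sup>2 * (x \<bullet> x) + t\<^sup>2 * (x \<bullet> x) + 2 * t * (1 - t) * (s * (x \<bullet> x))"
        using assms(3,4) by (simp add: normalized_iff_inner angle)
      also have "\<dots> = D t * (x \<bullet> x)"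
        by (simp add: D_def power2_eq_square algebra_simps)
      finally have "z \<bullet> z = D t * (x \<bullet> x)" .
      moreover have "g t *v x = (1 / sqrt (D t)) *\<^sub>R z"
        by (simp add: g_def z_def matrix_vector_mult_add_rdistrib scaleR_add_right
            flip: scaleR_matrix_vector_assoc)
      ultimately have "(g t *v x) \<bullet> (g t *v x) = x \<bullet> x"
        using D_pos[of t] by (simp add: field_simps)
      then show ?thesis
        by (simp add: norm_eq_sqrt_inner)
    qed
    then have "normalized (g t)" by (simp add: normalized_iff_norm)
    moreover have "is_representation \<Gamma> T (g t)"
      unfolding g_def using rep by (rule is_representation_linear_combination)
    ultimately show ?thesis
      by (auto simp: normalized_arrangements_def is_arrangement_def)
  qed
  moreover have "continuous_on {0..1} g"
  proof -
    have "sqrt (D t) \<noteq> 0" for t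
      using D_pos[of t] by simp
    moreover have "continuous_on {0..1} D"
      unfolding D_def by (intro continuous_intros)
    ultimately show ?thesis
      unfolding g_def by (intro continuous_intros) auto
  qed
  moreover have "g 0 = v" "g 1 = w"
    by (simp_all add: g_def D_def)
  ultimately show ?thesis
    unfolding path_component_def path_def path_image_def pathstart_def pathfinish_def
    by blast
qed

lemma deformation_equivalent_iff_path_component:
  "deformation_equivalent \<Gamma> v w \<longleftrightarrow> path_component (normalized_arrangements \<Gamma>) v w"
  unfolding deformation_equivalent_def path_component_def path_def path_image_def
    pathstart_def pathfinish_def by (rule refl)

section \<open>Deforming non-equivalent arrangements\<close>

theorem corollary5p14:
  fixes \<Gamma> :: "('n::finite \<Rightarrow> 'n) set"
    and v w :: "real^'d::finite^'n"
  assumes "odd CARD('d)"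
    and "permutation_group \<Gamma>"
    and "v \<in> normalized_arrangements \<Gamma>"
    and "w \<in> normalized_arrangements \<Gamma>"
    and "\<not> equivalent_arrangements v w"
    and "irreducible_arrangement \<Gamma> v"
    and "irreducible_arrangement \<Gamma> w"
    and "\<not> orthogonal_spaces (arrangement_space v) (arrangement_space w)"
  shows "deformation_equivalent \<Gamma> v w"
proof -
  obtain T where T: "is_representation \<Gamma> T v" and irred: "irreducible_representation \<Gamma> T"
    using assms(6) by (auto simp: irreducible_arrangement_def)
  obtain S where S: "is_representation \<Gamma> S w"
    using assms(4) by (auto simp: normalized_arrangements_def is_arrangement_def)
  have v_norm: "(v *v x) \<bullet> (v *v x) = x \<bullet> x" and w_norm: "(w *v x) \<bullet> (w *v x) = x \<bullet> x" for x
    using assms(3,4) by (auto simp: normalized_arrangements_def normalized_iff_inner)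
  define M where "M = transpose w ** v"
  have inner_M: "(w *v y) \<bullet> (v *v x) = y \<bullet> (M *v x)" for x y
    unfolding M_def by (rule inner_matrix_vector_mult)
  have M: "M *v (T \<phi> *v x) = S \<phi> *v (M *v x)" if "\<phi> \<in> \<Gamma>" for \<phi> x
    unfolding M_def using assms(2) T S that by (rule cross_gram_intertwines)
  obtain c where "c \<ge> 0" and norm_M: "\<And>x. norm (M *v x) = c * norm x"
  proof (rule irreducible_imp_norm_scaling[OF irred, of M])
    fix \<phi> x assume "\<phi> \<in> \<Gamma>"
    then have "orthogonal_matrix (T \<phi>)" "orthogonal_matrix (S \<phi>)"
      using T S by (auto intro: is_representation_orthogonal)
    then show "norm (T \<phi> *v x) = norm x" "norm (M *v (T \<phi> *v x)) = norm (M *v x)"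
      using \<open>\<phi> \<in> \<Gamma>\<close> by (auto simp: M orthogonal_matrix_iff_norm)
  qed blast
  have "c \<noteq> 0"
  proof
    assume "c = 0"
    then have "M *v x = 0" for x using norm_M[of x] by simp
    then have "(v *v x) \<bullet> (w *v y) = 0" for x y
      using inner_M[of y x] by (simp add: inner_commute)
    then show False
      using assms(8)
      by (auto simp: orthogonal_spaces_def arrangement_space_eq_range orthogonal_def)
  qed
  with \<open>c \<ge> 0\<close> have "c > 0" by simp
  have "orthogonal_matrix ((1 / c) *\<^sub>R M)"
    using \<open>c > 0\<close> by (simp add: orthogonal_matrix_iff_norm norm_M flip: scaleR_matrix_vector_assoc)
  then have "(1 / c) *\<^sub>R M \<asymp> mat 1 \<or> - ((1 / c) *\<^sub>R M) \<asymp> mat 1"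
    by (rule orthogonal_matrix_or_minus_connected_identity[OF assms(1)])
  \<comment> \<open>The sign \<open>e\<close> selects the one of the two matrices that lies in the identity component.\<close>
  then obtain e :: real where "\<bar>e\<bar> = 1" and connected: "(e / c) *\<^sub>R M \<asymp> mat 1"
    by (metis abs_1 abs_minus_cancel minus_divide_left scaleR_minus_left)
  define Q where "Q = (e / c) *\<^sub>R M"
  have Q: "orthogonal_matrix Q"
    using connected path_component_mem(1) unfolding Q_def by blast
  have Q_mult: "Q *v x = (e / c) *\<^sub>R (M *v x)" for x
    by (simp add: Q_def flip: scaleR_matrix_vector_assoc)
  have angle: "(v *v x) \<bullet> ((w ** Q) *v x) = (e * c) * (x \<bullet> x)" for x
  proof -
    have "(v *v x) \<bullet> ((w ** Q) *v x) = (Q *v x) \<bullet> (M *v x)"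
      using inner_M[of "Q *v x" x] by (simp add: matrix_vector_mul_assoc inner_commute)
    also have "\<dots> = (e / c) * (norm (M *v x))\<^sup>2"
      by (simp add: Q_mult power2_norm_eq_inner)
    also have "\<dots> = (e * c) * (x \<bullet> x)"
      using \<open>c > 0\<close> by (simp add: norm_M power_mult_distrib power2_norm_eq_inner)
         (simp add: power2_eq_square)
    finally show ?thesis .
  qed
  have "c < 1"
  proof (rule ccontr)
    assume "\<not> c < 1"
    \<comment> \<open>The squared distance of the two sides is \<open>2 (1 - c) \<bar>x\<bar>\<^sup>2\<close>, which cannot be positive.\<close>
    have eq: "e *\<^sub>R (v *v x) = w *v (Q *v x)" for x
    proof -
      define y where "y = e *\<^sub>R (v *v x) - (w ** Q) *v x"
      have "((w ** Q) *v x) \<bullet> ((w ** Q) *v x) = x \<bullet> x"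
        using Q by (simp add: w_norm inner_orthogonal_matrix flip: matrix_vector_mul_assoc)
      moreover have "e * e = 1"
        using \<open>\<bar>e\<bar> = 1\<close> by (metis abs_mult_self_eq mult_1)
      moreover have "y \<bullet> y = (e * e) * ((v *v x) \<bullet> (v *v x))
          - 2 * (e * ((v *v x) \<bullet> ((w ** Q) *v x))) + ((w ** Q) *v x) \<bullet> ((w ** Q) *v x)"
        by (simp add: y_def inner_diff inner_commute)
      moreover have "e * ((e * c) * (x \<bullet> x)) = (e * e) * (c * (x \<bullet> x))"
        by (simp only: mult.assoc)
      ultimately have "y \<bullet> y = 1 * (x \<bullet> x) - 2 * (1 * (c * (x \<bullet> x))) + x \<bullet> x"
        by (simp only: angle v_norm)
      also have "\<dots> = 2 * (1 - c) * (x \<bullet> x)"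
        by (simp add: algebra_simps)
      also have "\<dots> \<le> 0"
        using \<open>\<not> c < 1\<close> by (simp add: mult_nonpos_nonneg)
      finally have "y = 0" by (metis inner_gt_zero_iff not_le)
      then show ?thesis by (simp add: y_def matrix_vector_mul_assoc)
    qed
    have "arrangement_space v = arrangement_space w"
      unfolding arrangement_space_eq_range
    proof (intro equalityI subsetI)
      fix z assume "z \<in> range ((*v) v)"
      then obtain x where x: "z = v *v x" by blast
      have "e *\<^sub>R e *\<^sub>R z = z"
        using \<open>\<bar>e\<bar> = 1\<close> by (metis abs_mult_self_eq mult_1 scaleR_one scaleR_scaleR)
      then have "z = w *v (e *\<^sub>R (Q *v x))"
        using eq[of x] by (simp add: x matrix_vector_mult_scaleR)
      then show "z \<in> range ((*v) w)" by blast
    next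
      fix z assume "z \<in> range ((*v) w)"
      then obtain y where y: "z = w *v y" by blast
      have "Q *v (transpose Q *v y) = y"
        using Q by (metis matrix_vector_mul_assoc matrix_vector_mul_lid orthogonal_matrix_def)
      then have "z = v *v (e *\<^sub>R (transpose Q *v y))"
        using eq[of "transpose Q *v y"] by (simp add: y matrix_vector_mult_scaleR)
      then show "z \<in> range ((*v) v)" by blast
    qed
    with assms(5) show False by (simp add: equivalent_arrangements_def)
  qed
  have "is_representation \<Gamma> T (w ** Q)"
  proof (rule is_representation_mult[OF S Q])
    show "T \<in> hom ((BijGroup UNIV)\<lparr>carrier := \<Gamma>\<rparr>) orthogonal_group"
      using T by (simp add: is_representation_def)
    show "Q ** T \<phi> = S \<phi> ** Q" if "\<phi> \<in> \<Gamma>" for \<phi>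
      using M[OF that]
      by (simp add: matrix_eq Q_mult matrix_vector_mult_scaleR flip: matrix_vector_mul_assoc)
  qed
  moreover have "normalized v" "normalized (w ** Q)"
    using assms(3) normalized_arrangements_mult[OF assms(4) Q]
    by (auto simp: normalized_arrangements_def)
  moreover have "\<bar>e * c\<bar> < 1"
    using \<open>\<bar>e\<bar> = 1\<close> \<open>c < 1\<close> \<open>c > 0\<close> by (simp add: abs_mult)
  ultimately have "path_component (normalized_arrangements \<Gamma>) v (w ** Q)"
    using path_component_common_representation[OF T _ _ _ angle] by blast
  moreover have "path_component (normalized_arrangements \<Gamma>) (w ** Q) (w ** mat 1)"
    using connected unfolding Q_def[symmetric]
    by (rule path_component_continuous_image)
       (auto simp: continuous_on_matrix_mult_left normalized_arrangements_mult[OF assms(4)])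
  ultimately show ?thesis
    unfolding deformation_equivalent_iff_path_component
    using path_component_trans by fastforce
qed

end
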